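(* Let $V$ be a real or complex vector space (of arbitrary dimension). Then its additive group $(V,+)$ is natural.
   Context: A group $(G,* )$ is called natural if there exists a metric $d$ on the set $G$ such that (i) all right translations $x \mapsto x*a$ ($a \in G$) are isometries of $(G,d)$, and (ii) every group structure $(G,\circ)$ on the same set $G$ for which all right translations $x \mapsto x \circ a$ are isometries of $(G,d)$ is isomorphic as a group to $(G,* )$. *)

theory Defs
  imports "HOL-Analysis.Analysis" "HOL-Algebra.Group"
begin

definition metric_isometry :: "'a set \<Rightarrow> ('a \<Rightarrow> 'a \<Rightarrow> real) \<Rightarrow> ('a \<Rightarrow> 'a) \<Rightarrow> bool" where
  "metric_isometry M d f \<longleftrightarrow>
     bij_betw f M M \<and> (\<forall>x\<in>M. \<forall>y\<in>M. d (f x) (f y) = d x y)"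

definition right_translations_isometric :: "('a, 'b) monoid_scheme \<Rightarrow> ('a \<Rightarrow> 'a \<Rightarrow> real) \<Rightarrow> bool" where
  "right_translations_isometric G d \<longleftrightarrow>
     (\<forall>a\<in>carrier G. metric_isometry (carrier G) d (\<lambda>x. x \<otimes>\<^bsub>G\<^esub> a))"

(* Competing group structures H range over records on the same carrier; only the
   multiplication matters, since the unit of a group is determined by it. *)
definition natural_group :: "('a, 'b) monoid_scheme \<Rightarrow> bool" where
  "natural_group G \<longleftrightarrow>
     group G \<and>
     (\<exists>d. Metric_space (carrier G) d \<and>
          right_translations_isometric G d \<and>
          (\<forall>H :: 'a monoid.
             group H \<longrightarrow> carrier H = carrier G \<longrightarrow>
             right_translations_isometric H d \<longrightarrow> H \<cong> G))"

definition additive_group :: "'a::ab_group_add monoid" where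
  "additive_group = \<lparr>carrier = UNIV, monoid.mult = (+), one = 0\<rparr>"

end

theory Submission
  imports Defs
begin

text \<open>
  A metric that realises naturality cannot have only the translations as isometries: for every
  translation-invariant metric on an abelian group the reflections \<open>x \<mapsto> c - x\<close> are isometries too.
  The proof constructs a metric on \<open>V\<close> with no further isometries, and this is enough. Right
  multiplication by an element other than the unit has no fixed point, whereas a reflection
  \<open>x \<mapsto> c - x\<close> fixes \<open>c / 2\<close>. Hence all right translations of a competing group structure with unit
  \<open>e\<close> are ordinary translations, which forces its multiplication to be \<open>(x, a) \<mapsto> x + a - e\<close>, and
  \<open>x \<mapsto> x - e\<close> is an isomorphism onto the additive group.

  To construct the metric, only the structure of \<open>V\<close> as a rational vector space is used. Choose a
  basis and a well-order, and colour a vector by the size of its support, the absolute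
  value of its leading coordinate and the absolute value of the sum of its coordinates. There are
  countably many colours, because there are countably many scalars, so the colours can be injected
  into the interval from 1 to 2. There the triangle inequality holds automatically, and the distance
  between distinct \<open>x\<close> and \<open>y\<close> may be taken to be the number that encodes the colour of \<open>x - y\<close>.

  Let \<open>g\<close> be an isometry with \<open>g 0 = 0\<close>. Each component of the colour has its role. The support size
  shows that basis vectors go to scalar multiples of basis vectors, and the sum of coordinates that
  these are basis vectors up to one common sign, say \<open>+\<close>. The leading coordinate of \<open>2 b - c\<close>
  tells which of two basis vectors comes first, so \<open>g\<close> induces an order automorphism of a
  well-ordered set, which is the identity. Comparison with \<open>b\<close> shows that \<open>g\<close> fixes all
  multiples \<open>q b\<close> as well. Finally, the coordinate of a general vector \<open>x\<close> at an element \<open>b\<close> of its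
  support can be read off from the distances to the multiples of \<open>b\<close>: it is the only factor \<open>q\<close> for
  which \<open>x - q b\<close> has smaller support than \<open>x\<close>. Therefore \<open>g\<close> is the identity
  (\<open>colour_isometry_is_plus_or_minus_identity\<close> includes the other sign).
\<close>

section \<open>Colouring the vectors of a rational vector space\<close>

locale ordered_rational_basis = vector_space scale
  for scale :: "rat \<Rightarrow> 'v::ab_group_add \<Rightarrow> 'v" (infixr "*q" 75) +
  fixes B :: "'v set" and r :: "('v \<times> 'v) set"
  assumes indep: "independent B" and spans: "span B = UNIV"
    and wellorder: "Well_order r" and Field_r: "Field r = UNIV"
begin

definition coord :: "'v \<Rightarrow> 'v \<Rightarrow> rat" where
  "coord = representation B"

definition supp :: "'v \<Rightarrow> 'v set" where
  "supp x = {b. coord x b \<noteq> 0}"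

text \<open>For \<open>x = 0\<close> the support has no minimum, but every coordinate of \<open>x\<close> is 0, so the value is 0.\<close>

definition leading :: "'v \<Rightarrow> rat" where
  "leading x = coord x (wo_rel.minim r (supp x))"

definition total :: "'v \<Rightarrow> rat" where
  "total x = (\<Sum>b\<in>supp x. coord x b)"

text \<open>
  The absolute values make the colour even, as a distance requires.
\<close>

definition colour :: "'v \<Rightarrow> nat \<times> rat \<times> rat" where
  "colour x = (card (supp x), \<bar>leading x\<bar>, \<bar>total x\<bar>)"

lemma coord_diff [simp]: "coord (x - y) b = coord x b - coord y b"
  by (simp add: coord_def representation_diff indep spans)

lemma coord_minus [simp]: "coord (- x) b = - coord x b"
  by (simp add: coord_def representation_neg indep spans)

lemma coord_zero [simp]: "coord 0 b = 0"
  by (simp add: coord_def representation_zero)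

lemma coord_scale [simp]: "coord (q *q x) b = q * coord x b"
  by (simp add: coord_def representation_scale indep spans)

lemma coord_basis: "b \<in> B \<Longrightarrow> coord b c = (if c = b then 1 else 0)"
  by (simp add: coord_def representation_basis indep)

lemma in_supp_iff: "b \<in> supp x \<longleftrightarrow> coord x b \<noteq> 0"
  by (simp add: supp_def)

lemma finite_supp [simp]: "finite (supp x)"
  by (simp add: supp_def coord_def finite_representation)

lemma supp_subset_basis: "supp x \<subseteq> B"
  by (auto simp: supp_def coord_def representation_ne_zero)

lemma vector_eqI: "x = y" if "\<And>b. coord x b = coord y b"
proof -
  have expand: "(\<Sum>b | coord z b \<noteq> 0. coord z b *q b) = z" for z
    unfolding coord_def by (rule sum_nonzero_representation_eq[OF indep]) (simp add: spans)
  have "coord x = coord y" using that by blast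
  then show ?thesis using expand[of x, symmetric] expand[of y] by (elim trans) simp
qed

lemma supp_empty_iff [simp]: "supp x = {} \<longleftrightarrow> x = 0"
  by (auto simp: supp_def intro: vector_eqI)

lemma supp_zero [simp]: "supp 0 = {}"
  by simp

lemma supp_basis: "b \<in> B \<Longrightarrow> supp b = {b}"
  by (auto simp: supp_def coord_basis)

lemma supp_scale_basis: "b \<in> B \<Longrightarrow> q \<noteq> 0 \<Longrightarrow> supp (q *q b) = {b}"
  by (auto simp: supp_def coord_basis)

lemma supp_diff_subset: "supp (x - y) \<subseteq> supp x \<union> supp y"
  by (auto simp: supp_def)

lemma total_superset:
  assumes "finite A" "supp x \<subseteq> A" shows "total x = (\<Sum>b\<in>A. coord x b)"
  unfolding total_def by (rule sum.mono_neutral_left) (use assms in \<open>auto simp: supp_def\<close>)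

text \<open>
  Linearity of \<^const>\<open>total\<close> is what allows the isometries to be compared with each other: it
  turns colours of differences into differences of values.
\<close>

lemma total_diff [simp]: "total (x - y) = total x - total y"
  using total_superset[of "supp x \<union> supp y"] supp_diff_subset[of x y]
  by (simp add: sum_subtractf)

lemma total_minus [simp]: "total (- x) = - total x"
  by (simp add: total_def supp_def sum_negf)

lemma total_scale_basis [simp]:
  assumes "b \<in> B" shows "total (q *q b) = q"
proof -
  have "supp (q *q b) \<subseteq> {b}" using assms by (auto simp: supp_def coord_basis)
  then show ?thesis using total_superset[of "{b}"] assms by (simp add: coord_basis)
qed

lemma total_basis [simp]: "b \<in> B \<Longrightarrow> total b = 1"
  using total_scale_basis[of b 1] by simp

lemma colour_minus [simp]: "colour (- x) = colour x"
  by (simp add: colour_def leading_def) (simp add: supp_def)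

lemma scalar_multiple_of_basis_if_card_supp:
  assumes "card (supp x) = 1"
  obtains b where "b \<in> B" "x = total x *q b"
proof -
  from assms obtain b where b: "supp x = {b}"
    by (auto simp: card_1_singleton_iff)
  then have "b \<in> B" using supp_subset_basis by blast
  moreover have "coord x c = 0" if "c \<noteq> b" for c
    using b that by (auto simp: supp_def set_eq_iff)
  then have "x = total x *q b"
    by (intro vector_eqI) (simp add: total_def b \<open>b \<in> B\<close> coord_basis)
  ultimately show ?thesis by (rule that)
qed

text \<open>
  The colours see the order of the basis: \<open>2 b - c\<close> has the coordinates \<open>2\<close> and \<open>- 1\<close>, and the
  coefficient 2 is the leading one exactly if \<open>b\<close> comes first.
\<close>

lemma leading_order:
  assumes "b \<in> B" "c \<in> B" "b \<noteq> c"
  shows "\<bar>leading (2 *q b - c)\<bar> = 2 \<longleftrightarrow> (b, c) \<in> r"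
proof -
  interpret wo_rel r using wellorder by (simp add: wo_rel_def)
  have S: "supp (2 *q b - c) = {b, c}"
    using assms by (auto simp: supp_def coord_basis)
  have "minim {b, c} \<in> {b, c}" by (rule minim_in) (auto simp: Field_r)
  moreover have "(minim {b, c}, b) \<in> r" "(minim {b, c}, c) \<in> r"
    by (auto intro!: minim_least simp: Field_r)
  moreover have "(b, c) \<in> r \<Longrightarrow> (c, b) \<in> r \<Longrightarrow> False"
    using ANTISYM assms(3) by (auto dest: antisymD)
  ultimately show ?thesis
    using assms by (auto simp: leading_def S coord_basis)
qed

section \<open>Rigidity of the colouring\<close>

text \<open>
  This is the rigidity of well-orders, and the reason why the basis is well-ordered and not merely
  linearly ordered: if \<open>p\<close> fixes everything below \<open>b\<close>, it can neither send \<open>b\<close> below itself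
  (injectivity) nor skip \<open>b\<close> (surjectivity and monotonicity).
\<close>

lemma order_preserving_permutation_of_basis_is_identity:
  assumes p: "bij_betw p B B"
    and mono: "\<And>b c. b \<in> B \<Longrightarrow> c \<in> B \<Longrightarrow> (b, c) \<in> r \<Longrightarrow> (p b, p c) \<in> r"
  shows "b \<in> B \<Longrightarrow> p b = b"
proof (induction b rule: wo_rel.well_order_induct[of r, unfolded wo_rel_def, OF wellorder])
  case (1 b)
  interpret wo_rel r using wellorder by (simp add: wo_rel_def)
  have inj: "inj_on p B" and img: "p ` B = B" using p by (auto simp: bij_betw_def)
  have total: "(x, y) \<in> r \<or> (y, x) \<in> r" for x y
    using TOTALS by (auto simp: Field_r)
  have antisym: "(x, y) \<in> r \<Longrightarrow> (y, x) \<in> r \<Longrightarrow> x = y" for x y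
    using ANTISYM by (auto dest: antisymD)
  obtain a where a: "a \<in> B" "p a = b" using img \<open>b \<in> B\<close> by (metis imageE)
  have pb: "p b \<in> B" using img \<open>b \<in> B\<close> by auto
  show ?case
  proof (cases "(p b, b) \<in> r")
    case True
    then show ?thesis using "1.IH" pb inj \<open>b \<in> B\<close> by (metis inj_onD)
  next
    case False
    then have "(b, p b) \<in> r" using total by blast
    then show ?thesis
      using a "1.IH"[rule_format, of a] mono[of b a] total[of a b] antisym[of b "p b"] \<open>b \<in> B\<close>
      by metis
  qed
qed

text \<open>
  One basis vector that is sent to a basis vector, and not to the negative of one, decides the sign
  for all of them, because the coordinate sum of \<open>b - b0\<close> is 0 and that of \<open>- b - b0\<close> is not.
\<close>

lemma colour_isometry_fixing_sign_is_identity: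
  assumes surj: "surj g" and zero: "g 0 = 0"
    and iso: "\<And>x y. colour (g x - g y) = colour (x - y)"
    and b0: "b0 \<in> B" "g b0 \<in> B"
  shows "g x = x"
proof -
  have card: "card (supp (g x - g y)) = card (supp (x - y))"
    and leading: "\<bar>leading (g x - g y)\<bar> = \<bar>leading (x - y)\<bar>"
    and total: "\<bar>total (g x) - total (g y)\<bar> = \<bar>total x - total y\<bar>" for x y
    using iso[of x y] by (auto simp: colour_def)
  have card0: "card (supp (g x)) = card (supp x)" for x
    using card[of x 0] zero by simp
  have total0: "\<bar>total (g x)\<bar> = \<bar>total x\<bar>" for x
    using total[of x 0] zero by (simp add: total_def)
  have inj: "x = y" if "g x = g y" for x y
    using card[of x y] that by simp
  have basis: "g b \<in> B" if "b \<in> B" for b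
  proof -
    have "total (g b) = 1"
      using total[of b b0] that b0 by simp
    then show ?thesis
      using scalar_multiple_of_basis_if_card_supp[of "g b"] card0[of b] that
      by (auto simp: supp_basis)
  qed
  have scaled: "g (q *q b) = q *q g b" if b: "b \<in> B" for q b
  proof (cases "q = 0 \<or> q = 1")
    case True
    then show ?thesis using zero by auto
  next
    case False
    obtain c where c: "c \<in> B" "g (q *q b) = total (g (q *q b)) *q c"
      using scalar_multiple_of_basis_if_card_supp[of "g (q *q b)"] card0[of "q *q b"] b False
      by (auto simp: supp_scale_basis)
    define t where "t = total (g (q *q b))"
    \<comment> \<open>The colours of \<open>q b\<close> and \<open>q b - b\<close> give \<open>\<bar>t\<bar> = \<bar>q\<bar>\<close> and
      \<open>\<bar>t - 1\<bar> = \<bar>q - 1\<bar>\<close>; the second equation excludes \<open>t = - q\<close>.\<close>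
    have t: "t = q"
      using total0[of "q *q b"] total[of "q *q b" b] basis[OF that] that False
      by (auto simp: t_def)
    \<comment> \<open>If \<open>c\<close> were different from \<open>g b\<close>, the image of \<open>q b - b\<close> would have two
      nonzero coordinates.\<close>
    have "supp (q *q b - b) \<subseteq> {b}"
      using that by (auto simp: supp_def coord_basis)
    then have "card (supp (q *q b - b)) \<le> 1"
      by (metis card_mono finite.emptyI finite_insert card.empty card_insert_disjoint empty_iff One_nat_def)
    moreover have "supp (q *q c - g b) = {c, g b}" if "c \<noteq> g b"
      using that c(1) basis[OF \<open>b \<in> B\<close>] False by (auto simp: supp_def coord_basis)
    moreover have "card (supp (q *q c - g b)) = card (supp (q *q b - b))"
      using card[of "q *q b" b] c(2) t unfolding t_def by simp
    ultimately have "c = g b" by (cases "c = g b") simp_all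
    then show ?thesis using c(2) t unfolding t_def by simp
  qed
  have bij: "bij_betw g B B"
    unfolding bij_betw_def
  proof (intro conjI subset_antisym subsetI)
    show "inj_on g B" by (auto intro: inj_onI inj)
    show "b \<in> B" if "b \<in> g ` B" for b using that basis by auto
    show "b \<in> g ` B" if b: "b \<in> B" for b
    proof -
      obtain x where x: "g x = b" using surj by (metis surj_def)
      then obtain c where c: "c \<in> B" "x = total x *q c"
        using scalar_multiple_of_basis_if_card_supp[of x] card0[of x] b
        by (auto simp: supp_basis)
      have "b = total x *q g c" using scaled[OF c(1)] x c(2) by metis
      then have "total x = 1" using total_scale_basis[OF basis[OF c(1)]] that by (metis total_basis)
      then show ?thesis using c x by auto
    qed
  qed
  have fixes_basis: "g b = b" if "b \<in> B" for b
  proof (rule order_preserving_permutation_of_basis_is_identity[OF bij _ that])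
    fix b c assume bc: "b \<in> B" "c \<in> B" "(b, c) \<in> r"
    interpret wo_rel r using wellorder by (simp add: wo_rel_def)
    show "(g b, g c) \<in> r"
    proof (cases "b = c")
      case True
      then show ?thesis using REFL by (auto simp: Field_r refl_on_def)
    next
      case False
      then have "g b \<noteq> g c" using inj by blast
      then show ?thesis
        using leading_order[of b c] leading_order[of "g b" "g c"] leading[of "2 *q b" c]
          False bc basis scaled by simp
    qed
  qed
  \<comment> \<open>Subtracting \<open>q b\<close> from a vector makes the support smaller only if \<open>q\<close> is the
    coordinate at \<open>b\<close>, and \<open>g\<close> fixes \<open>q b\<close>.\<close>
  have agree: "coord (g x) b = coord x b" if b: "b \<in> supp x" for b
  proof (rule ccontr)
    let ?q = "coord x b"
    assume ne: "coord (g x) b \<noteq> ?q"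
    have "b \<in> B" using b supp_subset_basis by blast
    have "supp (x - ?q *q b) = supp x - {b}"
      using \<open>b \<in> B\<close> by (auto simp: supp_def coord_basis split: if_splits)
    then have "card (supp (x - ?q *q b)) < card (supp x)"
      using b by (metis card_Diff1_less finite_supp)
    moreover have "supp (g x) \<subseteq> supp (g x - ?q *q b)"
      using ne \<open>b \<in> B\<close> by (auto simp: supp_def coord_basis)
    then have "card (supp (g x)) \<le> card (supp (g x - ?q *q b))"
      by (simp add: card_mono)
    ultimately show False
      using card[of x "?q *q b"] scaled[OF \<open>b \<in> B\<close>] fixes_basis[OF \<open>b \<in> B\<close>] card0[of x] by simp
  qed
  have "supp x \<subseteq> supp (g x)" using agree by (auto simp: supp_def)
  then have "supp x = supp (g x)" using card0[of x] by (metis card_subset_eq finite_supp)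
  then have "coord (g x) b = coord x b" for b
    using agree[of b] by (metis in_supp_iff)
  then show ?thesis by (rule vector_eqI)
qed

lemma colour_isometry_is_plus_or_minus_identity:
  assumes surj: "surj g" and zero: "g 0 = 0"
    and iso: "\<And>x y. colour (g x - g y) = colour (x - y)"
  shows "(\<forall>x. g x = x) \<or> (\<forall>x. g x = - x)"
proof (cases "B = {}")
  case True
  then have "x = 0" for x :: 'v using supp_subset_basis[of x] True supp_empty_iff[of x] by blast
  then show ?thesis by metis
next
  case False
  then obtain b where b: "b \<in> B" by auto
  have "card (supp (g b)) = 1" "\<bar>total (g b)\<bar> = 1"
    using iso[of b 0] zero b by (auto simp: colour_def supp_basis)
  then obtain c where c: "c \<in> B" "g b = c \<or> g b = - c"
    using scalar_multiple_of_basis_if_card_supp[of "g b"]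
    by (metis abs_1 abs_eq_iff scale_minus_left scale_one)
  then show ?thesis
  proof (elim disjE)
    assume "g b = c"
    then show ?thesis
      using colour_isometry_fixing_sign_is_identity[OF surj zero iso b] c by simp
  next
    assume gb: "g b = - c"
    have surj': "surj (\<lambda>x. - g x)" using surj by (metis surj_def minus_minus)
    have iso': "colour (- g x - - g y) = colour (x - y)" for x y
      using iso[of x y] colour_minus[of "g x - g y"] by simp
    have "- g b \<in> B" using gb c(1) by simp
    then have neg: "- g x = x" for x
      using colour_isometry_fixing_sign_is_identity[OF surj' _ iso' b, of x] zero by simp
    have "g x = - x" for x
      using neg[of x] minus_equation_iff[of "g x" x] by simp
    then show ?thesis by blast
  qed
qed

section \<open>The metric and the groups with isometric right translations\<close>

text \<open>
  All distances between distinct points lie between 1 and 2, so that every choice of values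
  satisfies the triangle inequality; \<^const>\<open>to_nat\<close> keeps different colours apart.
\<close>

definition colour_dist :: "'v \<Rightarrow> 'v \<Rightarrow> real" where
  "colour_dist x y = (if x = y then 0 else 1 + 1 / (1 + real (to_nat (colour (x - y)))))"

lemma colour_dist_bounds: "x \<noteq> y \<Longrightarrow> 1 \<le> colour_dist x y" "colour_dist x y \<le> 2"
  by (auto simp: colour_dist_def field_simps)

lemma colour_dist_self [simp]: "colour_dist x x = 0"
  by (simp add: colour_dist_def)

lemma colour_dist_eq_0_iff [simp]: "colour_dist x y = 0 \<longleftrightarrow> x = y"
  using colour_dist_bounds(1)[of x y] by (cases "x = y") auto

lemma colour_dist_eqD:
  assumes "colour_dist x y = colour_dist x' y'"
  shows "colour (x - y) = colour (x' - y')"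
proof (cases "x = y")
  case True
  then have "x' = y'" using assms by simp
  with True show ?thesis by simp
next
  case False
  then have "x' \<noteq> y'" using assms by auto
  with False show ?thesis using assms by (simp add: colour_dist_def)
qed

lemma Metric_space_colour_dist: "Metric_space UNIV colour_dist"
proof
  fix x y z
  show "0 \<le> colour_dist x y" by (simp add: colour_dist_def)
  show "colour_dist x y = colour_dist y x"
    using colour_minus[of "x - y"] by (simp add: colour_dist_def)
  show "colour_dist x y = 0 \<longleftrightarrow> x = y" by simp
  show "colour_dist x z \<le> colour_dist x y + colour_dist y z"
    using colour_dist_bounds(1)[of x y] colour_dist_bounds(1)[of y z] colour_dist_bounds(2)[of x z]
    by (cases "x = y"; cases "y = z") auto
qed

lemma isometry_of_colour_dist:
  assumes "metric_isometry UNIV colour_dist f"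
  shows "(\<forall>x. f x = x + f 0) \<or> (\<forall>x. f x = f 0 - x)"
proof -
  define g where "g x = f x - f 0" for x
  have "surj f" using assms by (simp add: metric_isometry_def bij_def)
  then have "surj g" unfolding g_def surj_def by (metis add_diff_cancel_right')
  moreover have "colour (g x - g y) = colour (x - y)" for x y
    using assms colour_dist_eqD[of "f x" "f y" x y] by (simp add: g_def metric_isometry_def)
  ultimately have "(\<forall>x. g x = x) \<or> (\<forall>x. g x = - x)"
    by (intro colour_isometry_is_plus_or_minus_identity) (auto simp: g_def)
  then show ?thesis by (auto simp: g_def algebra_simps)
qed

text \<open>
  Here division by 2 enters: a right translation that was a reflection \<open>x \<mapsto> c - x\<close> would fix
  \<open>c / 2\<close>, and a right translation with a fixed point is the identity. So right multiplication
  by \<open>a\<close> is a translation, and its value \<open>a\<close> at the unit determines which one.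
\<close>

lemma right_translations_are_translations:
  fixes H :: "'v monoid"
  assumes H: "group H" "carrier H = UNIV" and iso: "right_translations_isometric H colour_dist"
  shows "x \<otimes>\<^bsub>H\<^esub> a = x + a - \<one>\<^bsub>H\<^esub>"
proof -
  interpret H: group H by (fact H)
  note UNIV [simp] = H(2)
  let ?f = "\<lambda>x. x \<otimes>\<^bsub>H\<^esub> a"
  have "metric_isometry UNIV colour_dist ?f"
    using iso by (simp add: right_translations_isometric_def)
  then consider "\<forall>x. ?f x = x + ?f 0" | "\<forall>x. ?f x = ?f 0 - x"
    using isometry_of_colour_dist by blast
  then have shift: "?f x = x + ?f 0" for x
  proof cases
    case 1
    then show ?thesis by blast
  next
    case 2
    define m where "m = (1/2) *q ?f 0"
    have "m + m = ?f 0"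
      unfolding m_def by (simp flip: scale_left_distrib)
    moreover have "?f m = ?f 0 - m" using 2 by blast
    ultimately have "m \<otimes>\<^bsub>H\<^esub> a = m" by (simp flip: \<open>m + m = ?f 0\<close>)
    then have "a = \<one>\<^bsub>H\<^esub>" by (simp add: H.r_cancel_one')
    then show ?thesis by simp
  qed
  have "\<one>\<^bsub>H\<^esub> + ?f 0 = a" using shift[of "\<one>\<^bsub>H\<^esub>", symmetric] by simp
  then have "?f 0 = a - \<one>\<^bsub>H\<^esub>" by (metis add_diff_cancel_left')
  then show ?thesis using shift[of x] by (simp add: add_diff_eq)
qed

end

section \<open>Rational, real and complex vector spaces\<close>

theorem natural_group_rational_vector_space:
  fixes scale :: "rat \<Rightarrow> 'v::ab_group_add \<Rightarrow> 'v"
  assumes "vector_space scale"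
  shows "natural_group (additive_group :: 'v monoid)"
proof -
  interpret vector_space scale by fact
  obtain B where B: "independent B" "UNIV \<subseteq> span B"
    by (rule maximal_independent_subset[of UNIV])
  obtain r :: "('v \<times> 'v) set" where r: "Well_order r" "Field r = UNIV"
    using well_ordering[where 'a = 'v] by (elim exE conjE)
  interpret ordered_rational_basis scale B r
    using B r by unfold_locales auto
  have "group (additive_group :: 'v monoid)"
  proof (rule groupI)
    show "\<exists>y\<in>carrier additive_group. y \<otimes>\<^bsub>additive_group\<^esub> x = \<one>\<^bsub>additive_group\<^esub>" for x :: 'v
      by (rule bexI[of _ "- x"]) (simp_all add: additive_group_def)
  qed (simp_all add: additive_group_def add.assoc)
  moreover have "right_translations_isometric additive_group colour_dist"
    unfolding right_translations_isometric_def metric_isometry_def additive_group_def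
    by (auto simp: colour_dist_def bij_plus_right)
  moreover have "H \<cong> (additive_group :: 'v monoid)"
    if H: "group H" "carrier H = UNIV" "right_translations_isometric H colour_dist"
    for H :: "'v monoid"
  proof (rule is_isoI)
    have "bij (\<lambda>x. x - \<one>\<^bsub>H\<^esub>)"
      by (rule bij_betw_byWitness[where f' = "\<lambda>x. x + \<one>\<^bsub>H\<^esub>"]) auto
    then show "(\<lambda>x. x - \<one>\<^bsub>H\<^esub>) \<in> iso H additive_group"
      using right_translations_are_translations[OF H]
      by (simp add: iso_def hom_def additive_group_def H(2) add_diff_eq diff_add_eq)
  qed
  ultimately show ?thesis
    unfolding natural_group_def using Metric_space_colour_dist
    by (intro conjI exI[of _ colour_dist]) (auto simp: additive_group_def)
qed

text \<open>
  Naturality concerns the additive group only, so the scalars may be restricted to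
  the rational numbers, which are common to both kinds of scalars and are countable.
\<close>

lemma vector_space_restrict_scalars_to_rat:
  fixes scale :: "'k::field_char_0 \<Rightarrow> 'v::ab_group_add \<Rightarrow> 'v"
  assumes "vector_space scale"
  shows "vector_space (\<lambda>q. scale (of_rat q))"
proof -
  interpret vector_space scale by fact
  show ?thesis
    by unfold_locales (simp_all add: scale_right_distrib scale_left_distrib of_rat_add of_rat_mult)
qed

theorem theorem5:
  assumes "(\<exists>scale :: real \<Rightarrow> 'v::ab_group_add \<Rightarrow> 'v. vector_space scale) \<or>
           (\<exists>scale :: complex \<Rightarrow> 'v \<Rightarrow> 'v. vector_space scale)"
  shows "natural_group (additive_group :: 'v monoid)"
  using assms
  by (elim disjE exE)
    (rule natural_group_rational_vector_space, erule vector_space_restrict_scalars_to_rat)+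

end
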